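(* Let $\mu=(\mu_0,\ldots,\mu_{T-1})\in\mathbb{R}_+^{T}$, let $U\in\mathcal{U}^{ad}$ be an admissible control sequence, and let $n=(n^a)_{a\in A}$ be an initial state with $n^a=(n^{\mathtt{B}a},n^{\mathtt{G}a})\in\mathbb{N}^2$ for each $a \in A$. Then $$V^r_0[\mu](n)-V^{U}_0(n)=\mathbb{E}_n\Big[\sum_{t=0}^{T-1}\sum_{a\in A}\big(I^a_t[\mu](N^{U,a}_t)-\mu_t\big)\cdot\big(u^{a,r}_t[\mu](N^{U,a}_t)-U^a_t\big)\Big],$$ where $$V_0^U(n)=\mathbb{E}_n\Big[\sum_{t=0}^{T-1}\sum_{a\in A}\ell^a_t(N^{U,a}_t)\cdot U^a_t\Big].$$
   Context: **Bandit model.** $T\ge 1$ is an integer (horizon), $A$ is a finite nonempty set (arms), $\mathbb{N}=\{1,2,\dots\}$. For each arm $a\in A$ and $t\in\{0,\dots,T-1\}$ a reward function $L^a_t:\{\mathtt{B},\mathtt{G}\}\to\mathbb{R}$ is given. A state is $n=(n^a)_{a\in A}$ with $n^a=(n^{\mathtt{B}a},n^{\mathtt{G}a})\in\mathbb{N}^2$. **Probability $\mathbb{E}_n$.** Given $n$, the unknown parameters $p^a=(p^{\mathtt{B}a},p^{\mathtt{G}a})$ (with $p^{\mathtt{B}a}+p^{\mathtt{G}a}=1$), $a\in A$, are independent, $p^{\mathtt{B}a}$ having the Beta distribution $\beta(n^{\mathtt{B}a},n^{\mathtt{G}a})$; conditionally on $(p^a)_{a\in A}$ the outcomes $W^a_t\in\{\mathtt{B},\mathtt{G}\}$,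 $a\in A$, $t\in\{1,\dots,T\}$, are independent with $W^a_t=\mathtt{G}$ with probability $p^{\mathtt{G}a}$ and $W^a_t=\mathtt{B}$ with probability $p^{\mathtt{B}a}$. $\mathbb{E}_n$ is the corresponding expectation. **Admissible controls $\mathcal{U}^{ad}$.** $U=(U^a_t)_{a\in A,\,t\in\{0,\dots,T-1\}}$ with $U_t^a\in\{0,1\}$, $\sum_{a\in A}U^a_t=1$ for all $t$ (exactly one arm is pulled at each stage), $U_0$ deterministic, and for $t\ge1$, $U_t=(U^a_t)_{a\in A}$ measurable with respect to $\sigma(U_0,Y_1,U_1,\dots,U_{t-1},Y_t)$, where the observation $Y_{t+1}=(Y_{t+1}^a)_{a\in A}$ is $Y_{t+1}^a=W^a_{t+1}$ if $U^a_t=1$ and $Y_{t+1}^a=0$ (nothing observed) if $U^a_t=0$. **State process.** $N^{U,a}_t=(N^{U,a,\mathtt{B}}_t,N^{U,a,\mathtt{G}}_t)$ with $N^{U,a,g}_t=n^{ga}+\sum_{s=0}^{t-1}U^a_s\mathbf{1}_{\{W^a_{s+1}=g\}}$ for $g\in\{\mathtt{B},\mathtt{G}\}$; so $N^{U,a}_0=n^a$. **Functions.** For $(b,g)\in\mathbb{N}^2$, $\ell^a_t(b,g)=\frac{b}{b+g}L^a_t(\mathtt{B})+\frac{g}{b+g}L^a_t(\mathtt{G})$, and for a function $\varphi$ on $\mathbb{N}^2$, $\overline{\overline{\varphi}}(b,g)=\frac{b}{b+g}\varphi(b+1,g)+\frac{g}{b+g}\varphi(b,g+1)$. For $\mu\in\mathbb{R}^T$,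 the single-arm value functions $V^a_t[\mu]:\mathbb{N}^2\to\mathbb{R}$ are defined by $V^a_T[\mu]=0$ and, for $t=T-1,\dots,0$, $$V^a_t[\mu](b,g)=\max\big\{V^a_{t+1}[\mu](b,g),\ -\mu_t+\ell^a_t(b,g)+\overline{\overline{V^a_{t+1}[\mu]}}(b,g)\big\}.$$ The value of the relaxed problem is $V^r_0[\mu](n)=\sum_{a\in A}V^a_0[\mu](n^a)+\sum_{t=0}^{T-1}\mu_t$. The index is $I^a_t[\mu](b,g)=\overline{\overline{V^a_{t+1}[\mu]}}(b,g)-V^a_{t+1}[\mu](b,g)+\ell^a_t(b,g)$, and $u^{a,r}_t[\mu](b,g)=1$ if $I^a_t[\mu](b,g)-\mu_t>0$ and $u^{a,r}_t[\mu](b,g)=0$ otherwise. *)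

theory Defs
  imports "HOL-Probability.Probability"
begin

datatype outcome = Bad | Good

text \<open>
  Pairs carry the \<open>Bad\<close> component first and the \<open>Good\<close> component second. This
  applies to arm states (pairs of positive naturals) and to the unknown parameters alike.
\<close>

primrec component :: "outcome \<Rightarrow> 'b \<times> 'b \<Rightarrow> 'b" where
  "component Bad x = fst x"
| "component Good x = snd x"

definition beta_density :: "real \<Rightarrow> real \<Rightarrow> real \<Rightarrow> real" where
  "beta_density a b x =
     (if 0 < x \<and> x < 1 then x powr (a - 1) * (1 - x) powr (b - 1) / Beta a b else 0)"

definition cond_indep_vars ::
  "'w measure \<Rightarrow> 'w measure \<Rightarrow> ('i \<Rightarrow> 'b measure) \<Rightarrow> ('i \<Rightarrow> 'w \<Rightarrow> 'b) \<Rightarrow> 'i set \<Rightarrow> bool" where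
  "cond_indep_vars M F N X I \<longleftrightarrow>
     (\<forall>i\<in>I. X i \<in> measurable M (N i)) \<and>
     (\<forall>J\<subseteq>I. J \<noteq> {} \<longrightarrow> finite J \<longrightarrow>
        (\<forall>C\<in>(\<Pi> j\<in>J. sets (N j)).
           AE \<omega> in M.
             real_cond_exp M F (indicator (\<Inter>j\<in>J. X j -` C j \<inter> space M)) \<omega> =
             (\<Prod>j\<in>J. real_cond_exp M F (indicator (X j -` C j \<inter> space M)) \<omega>)))"

definition params_algebra :: "'w measure \<Rightarrow> 'a set \<Rightarrow> ('a \<Rightarrow> 'w \<Rightarrow> real \<times> real) \<Rightarrow> 'w measure" where
  "params_algebra M A p =
     vimage_algebra (space M) (\<lambda>\<omega>. \<lambda>a\<in>A. p a \<omega>) (\<Pi>\<^sub>M a\<in>A. borel)"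

text \<open>
  The expectation \<open>E\<^sub>n\<close> is the expectation on an arbitrary probability space carrying
  parameters \<open>p\<close> and outcomes \<open>W\<close> with the joint law prescribed by the prior \<open>n\<close>.
\<close>

locale bandit = prob_space M
  for M :: "'w measure" +
  fixes A :: "'a set" and T :: nat and n :: "'a \<Rightarrow> nat \<times> nat"
    and p :: "'a \<Rightarrow> 'w \<Rightarrow> real \<times> real" and W :: "'a \<Rightarrow> nat \<Rightarrow> 'w \<Rightarrow> outcome"
  assumes params_sum:
    "\<And>a \<omega>. a \<in> A \<Longrightarrow> \<omega> \<in> space M \<Longrightarrow> component Bad (p a \<omega>) + component Good (p a \<omega>) = 1"
  and params_indep: "indep_vars (\<lambda>_. borel) p A"
  and params_beta:
    "\<And>a. a \<in> A \<Longrightarrow> distributed M lborel (\<lambda>\<omega>. component Bad (p a \<omega>))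
       (\<lambda>x. ennreal (beta_density (real (component Bad (n a))) (real (component Good (n a))) x))"
  and outcomes_cond_indep:
    "cond_indep_vars M (params_algebra M A p) (\<lambda>_. count_space UNIV) (\<lambda>(a, t). W a t) (A \<times> {1..T})"
  and outcomes_cond_law:
    "\<And>a t g. a \<in> A \<Longrightarrow> t \<in> {1..T} \<Longrightarrow>
       AE \<omega> in M. real_cond_exp M (params_algebra M A p)
         (indicator (W a t -` {g} \<inter> space M)) \<omega> = component g (p a \<omega>)"

text \<open>
  Observation at time \<open>t \<ge> 1\<close>; \<open>None\<close> stands for ``nothing observed'' (written 0 in informal
  notation).
\<close>

definition observation ::
  "('a \<Rightarrow> nat \<Rightarrow> 'w \<Rightarrow> outcome) \<Rightarrow> ('a \<Rightarrow> nat \<Rightarrow> 'w \<Rightarrow> nat) \<Rightarrow> 'a \<Rightarrow> nat \<Rightarrow> 'w \<Rightarrow> outcome option" where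
  "observation W U a t \<omega> = (if U a (t - 1) \<omega> = 1 then Some (W a t \<omega>) else None)"

text \<open>The \<open>\<sigma>\<close>-algebra generated by \<open>U\<^sub>0, Y\<^sub>1, U\<^sub>1, \<dots>, U\<^sub>t\<^sub>-\<^sub>1, Y\<^sub>t\<close>.\<close>

definition history_algebra ::
  "'w measure \<Rightarrow> 'a set \<Rightarrow> ('a \<Rightarrow> nat \<Rightarrow> 'w \<Rightarrow> outcome) \<Rightarrow> ('a \<Rightarrow> nat \<Rightarrow> 'w \<Rightarrow> nat) \<Rightarrow> nat \<Rightarrow> 'w measure" where
  "history_algebra M A W U t = sigma (space M)
     ({U a s -` C \<inter> space M | a s C. a \<in> A \<and> s \<in> {0..<t}} \<union>
      {observation W U a s -` C \<inter> space M | a s C. a \<in> A \<and> s \<in> {1..t}})"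

definition admissible ::
  "'w measure \<Rightarrow> 'a set \<Rightarrow> nat \<Rightarrow> ('a \<Rightarrow> nat \<Rightarrow> 'w \<Rightarrow> outcome) \<Rightarrow> ('a \<Rightarrow> nat \<Rightarrow> 'w \<Rightarrow> nat) \<Rightarrow> bool" where
  "admissible M A T W U \<longleftrightarrow>
     (\<forall>\<omega>\<in>space M. \<forall>t<T. (\<forall>a\<in>A. U a t \<omega> \<in> {0, 1}) \<and> (\<Sum>a\<in>A. U a t \<omega>) = 1) \<and>
     (\<exists>u. \<forall>a\<in>A. \<forall>\<omega>\<in>space M. U a 0 \<omega> = u a) \<and>
     (\<forall>t\<in>{1..<T}. \<forall>a\<in>A. U a t \<in> measurable (history_algebra M A W U t) (count_space UNIV))"

definition arm_count ::
  "('a \<Rightarrow> nat \<times> nat) \<Rightarrow> ('a \<Rightarrow> nat \<Rightarrow> 'w \<Rightarrow> outcome) \<Rightarrow> ('a \<Rightarrow> nat \<Rightarrow> 'w \<Rightarrow> nat) \<Rightarrow>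
     'a \<Rightarrow> outcome \<Rightarrow> nat \<Rightarrow> 'w \<Rightarrow> nat" where
  "arm_count n W U a g t \<omega> =
     component g (n a) + (\<Sum>s\<in>{0..<t}. U a s \<omega> * of_bool (W a (s + 1) \<omega> = g))"

definition arm_state ::
  "('a \<Rightarrow> nat \<times> nat) \<Rightarrow> ('a \<Rightarrow> nat \<Rightarrow> 'w \<Rightarrow> outcome) \<Rightarrow> ('a \<Rightarrow> nat \<Rightarrow> 'w \<Rightarrow> nat) \<Rightarrow>
     'a \<Rightarrow> nat \<Rightarrow> 'w \<Rightarrow> nat \<times> nat" where
  "arm_state n W U a t \<omega> = (arm_count n W U a Bad t \<omega>, arm_count n W U a Good t \<omega>)"

definition reward_mean :: "('a \<Rightarrow> nat \<Rightarrow> outcome \<Rightarrow> real) \<Rightarrow> 'a \<Rightarrow> nat \<Rightarrow> nat \<times> nat \<Rightarrow> real" where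
  "reward_mean L a t = (\<lambda>(b, g).
     real b / (real b + real g) * L a t Bad + real g / (real b + real g) * L a t Good)"

definition state_mean :: "(nat \<times> nat \<Rightarrow> real) \<Rightarrow> nat \<times> nat \<Rightarrow> real" where
  "state_mean \<phi> = (\<lambda>(b, g).
     real b / (real b + real g) * \<phi> (b + 1, g) + real g / (real b + real g) * \<phi> (b, g + 1))"

function arm_value ::
  "('a \<Rightarrow> nat \<Rightarrow> outcome \<Rightarrow> real) \<Rightarrow> nat \<Rightarrow> (nat \<Rightarrow> real) \<Rightarrow> 'a \<Rightarrow> nat \<Rightarrow> nat \<times> nat \<Rightarrow> real" where
  "arm_value L T \<mu> a t =
     (if T \<le> t then (\<lambda>x. 0)
      else (\<lambda>x. max (arm_value L T \<mu> a (t + 1) x)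
                    (- \<mu> t + reward_mean L a t x + state_mean (arm_value L T \<mu> a (t + 1)) x)))"
  by pat_completeness auto
termination
  by (relation "Wellfounded.measure (\<lambda>(L, T, \<mu>, a, t). T - t)") auto

declare arm_value.simps [simp del]

definition relaxed_value ::
  "'a set \<Rightarrow> ('a \<Rightarrow> nat \<Rightarrow> outcome \<Rightarrow> real) \<Rightarrow> nat \<Rightarrow> (nat \<Rightarrow> real) \<Rightarrow> ('a \<Rightarrow> nat \<times> nat) \<Rightarrow> real" where
  "relaxed_value A L T \<mu> n = (\<Sum>a\<in>A. arm_value L T \<mu> a 0 (n a)) + (\<Sum>t\<in>{0..<T}. \<mu> t)"

definition arm_index ::
  "('a \<Rightarrow> nat \<Rightarrow> outcome \<Rightarrow> real) \<Rightarrow> nat \<Rightarrow> (nat \<Rightarrow> real) \<Rightarrow> 'a \<Rightarrow> nat \<Rightarrow> nat \<times> nat \<Rightarrow> real" where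
  "arm_index L T \<mu> a t x =
     state_mean (arm_value L T \<mu> a (t + 1)) x - arm_value L T \<mu> a (t + 1) x + reward_mean L a t x"

definition relaxed_control ::
  "('a \<Rightarrow> nat \<Rightarrow> outcome \<Rightarrow> real) \<Rightarrow> nat \<Rightarrow> (nat \<Rightarrow> real) \<Rightarrow> 'a \<Rightarrow> nat \<Rightarrow> nat \<times> nat \<Rightarrow> nat" where
  "relaxed_control L T \<mu> a t x = (if arm_index L T \<mu> a t x - \<mu> t > 0 then 1 else 0)"

definition control_value ::
  "'w measure \<Rightarrow> 'a set \<Rightarrow> ('a \<Rightarrow> nat \<Rightarrow> outcome \<Rightarrow> real) \<Rightarrow> nat \<Rightarrow> ('a \<Rightarrow> nat \<times> nat) \<Rightarrow>
     ('a \<Rightarrow> nat \<Rightarrow> 'w \<Rightarrow> outcome) \<Rightarrow> ('a \<Rightarrow> nat \<Rightarrow> 'w \<Rightarrow> nat) \<Rightarrow> real" where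
  "control_value M A L T n W U =
     prob_space.expectation M (\<lambda>\<omega>.
       \<Sum>t\<in>{0..<T}. \<Sum>a\<in>A. reward_mean L a t (arm_state n W U a t \<omega>) * real (U a t \<omega>))"

end

theory Submission
  imports Defs
begin

text \<open>
  The recursion for the single-arm value says that \<open>V\<^sub>t\<close> exceeds \<open>V\<^sub>t\<^sub>+\<^sub>1\<close> by the positive part of
  \<open>I\<^sub>t - \<mu>\<^sub>t\<close>, that is, by \<open>(I\<^sub>t - \<mu>\<^sub>t) u\<^sub>t\<close> with \<open>u\<close> the relaxed control. Along the states \<open>N\<^sub>t\<close> of an
  arm under an admissible control \<open>U\<close>, the initial value telescopes into the sum of the expectations
  of \<open>V\<^sub>t(N\<^sub>t) - V\<^sub>t\<^sub>+\<^sub>1(N\<^sub>t\<^sub>+\<^sub>1)\<close>. If a pulled arm in state \<open>(b, g)\<close> moves to \<open>(b + 1, g)\<close> and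
  \<open>(b, g + 1)\<close> with probabilities \<open>b / (b + g)\<close> and \<open>g / (b + g)\<close> given the past, then
  \<open>V\<^sub>t\<^sub>+\<^sub>1(N\<^sub>t\<^sub>+\<^sub>1) - V\<^sub>t\<^sub>+\<^sub>1(N\<^sub>t)\<close> has the same expectation as \<open>U\<^sub>t (I\<^sub>t - \<ell>\<^sub>t)(N\<^sub>t)\<close>, by the definition of
  the index. Summing over the arms and using that exactly one arm is pulled at each stage, so that
  \<open>\<mu>\<^sub>t\<close> is the sum of \<open>\<mu>\<^sub>t U\<^sub>t\<close> over the arms, gives the claim.

  The main point is the predictive law (\<open>predictive_law\<close>): the model prescribes the law of
  the outcomes given the parameters, not their law given the observations of an adaptive control.
  For a sampling pattern fixed in advance, the probability of given outcomes is a product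
  over the arms of quotients of Beta values (\<open>prob_cylinder\<close>), and the recurrence of the Beta
  function yields the predictive law for that pattern (\<open>prob_next_outcome\<close>). An adaptive control
  reduces to this case: the observations made up to time \<open>t\<close> determine the choices up to and including
  time \<open>t\<close> (\<open>cell_control\<close>), so for each \<open>t\<close> the sample space splits into finitely many cells, each a cylinder for a fixed pattern, on which the state and the control are
  constant.
\<close>

section \<open>Moments of the Beta prior\<close>

lemma beta_moments:
  assumes "prob_space M"
    and X: "distributed M lborel X (\<lambda>x. ennreal (beta_density b g x))"
    and pos: "0 < b" "0 < g"
  shows "integrable M (\<lambda>\<omega>. X \<omega> ^ k * (1 - X \<omega>) ^ l)" (is ?integrable)
    and "prob_space.expectation M (\<lambda>\<omega>. X \<omega> ^ k * (1 - X \<omega>) ^ l) =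
      Beta (b + real k) (g + real l) / Beta b g" (is ?expectation)
proof -
  interpret prob_space M by fact
  let ?m = "\<lambda>x::real. x ^ k * (1 - x) ^ l"
  let ?h = "\<lambda>x. x powr (b + real k - 1) * (1 - x) powr (g + real l - 1)"
  have Beta_pos: "0 < Beta b g"
    using pos by (simp add: Beta_def Gamma_real_pos)
  have density_nonneg: "0 \<le> beta_density b g x" for x
    using Beta_pos by (simp add: beta_density_def)
  \<comment> \<open>The powers shift the two exponents of the density, and only its normalisation is left over.\<close>
  have tilt: "beta_density b g x * ?m x = indicator {0<..<1} x * ?h x / Beta b g" for x
  proof (cases "x \<in> {0<..<1}")
    case True
    then have "x powr (b + real k - 1) = x powr (b - 1) * x ^ k"
      "(1 - x) powr (g + real l - 1) = (1 - x) powr (g - 1) * (1 - x) ^ l"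
      by (simp_all add: powr_add[symmetric] powr_realpow[symmetric] algebra_simps)
    with True show ?thesis by (simp add: beta_density_def)
  qed (auto simp: beta_density_def)
  have "(?h has_integral Beta (b + real k) (g + real l)) {0<..<1}"
    using has_integral_Beta_real[of "b + real k" "g + real l"] pos
    by (simp add: has_integral_Icc_iff_Ioo)
  then have "integral\<^sup>N lborel (\<lambda>x. indicator {0<..<1} x * ?h x) = Beta (b + real k) (g + real l)"
    by (rule nn_integral_has_integral_lebesgue[rotated]) auto
  then have "has_bochner_integral lborel (\<lambda>x. indicator {0<..<1} x * ?h x) (Beta (b + real k) (g + real l))"
    using pos by (intro has_bochner_integral_nn_integral) (auto simp: Beta_def Gamma_real_pos less_imp_le)
  then have int: "has_bochner_integral lborel (\<lambda>x. beta_density b g x * ?m x)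
      (Beta (b + real k) (g + real l) / Beta b g)"
    unfolding tilt by (rule has_bochner_integral_divide_zero)
  show ?integrable
    using int distributed_integrable[OF X, of ?m] density_nonneg
    by (simp add: has_bochner_integral_iff)
  show ?expectation
    using int distributed_integral[OF X, of ?m] density_nonneg
    by (simp add: has_bochner_integral_iff)
qed

lemma Beta_succ_component:
  assumes "0 < b" "0 < (g::real)"
  shows "Beta (b + 1) g = b / (b + g) * Beta b g" "Beta b (g + 1) = g / (b + g) * Beta b g"
proof -
  have "b \<notin> \<int>\<^sub>\<le>\<^sub>0" "g \<notin> \<int>\<^sub>\<le>\<^sub>0"
    using assms by (auto simp: nonpos_Ints_def)
  with assms show "Beta (b + 1) g = b / (b + g) * Beta b g" "Beta b (g + 1) = g / (b + g) * Beta b g"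
    using Beta_plus1_left[of b g] Beta_plus1_right[of g b] by (auto simp: field_simps)
qed

section \<open>Conjugacy for a fixed sampling pattern\<close>

lemma prod_component_eq:
  assumes "finite S" and "fst x + snd x = (1::real)"
  shows "(\<Prod>t\<in>S. component (w t) x) =
    component Bad x ^ card {t\<in>S. w t = Bad} * (1 - component Bad x) ^ card {t\<in>S. w t = Good}"
proof -
  have "S = {t\<in>S. w t = Bad} \<union> {t\<in>S. w t = Good}"
    using outcome.exhaust by auto
  then have "(\<Prod>t\<in>S. component (w t) x) = (\<Prod>t\<in>{t\<in>S. w t = Bad} \<union> {t\<in>S. w t = Good}. component (w t) x)"
    by simp
  also have "\<dots> = (\<Prod>t\<in>{t\<in>S. w t = Bad}. component (w t) x) * (\<Prod>t\<in>{t\<in>S. w t = Good}. component (w t) x)"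
    using assms by (intro prod.union_disjoint) auto
  also have "\<dots> = fst x ^ card {t\<in>S. w t = Bad} * snd x ^ card {t\<in>S. w t = Good}"
    by simp
  also have "snd x = 1 - fst x"
    using assms(2) by simp
  finally show ?thesis
    by simp
qed

text \<open>A bandit with finitely many arms and a prior with positive counts.\<close>

locale proper_bandit = bandit M A T n p W
  for M :: "'w measure" and A :: "'a set" and T n p W +
  assumes finite_arms: "finite A"
    and prior_pos: "\<And>a g. a \<in> A \<Longrightarrow> component g (n a) \<ge> 1"
begin

lemma measurable_component_params [measurable]:
  assumes "a \<in> A"
  shows "p a \<in> borel_measurable M" "(\<lambda>\<omega>. component g (p a \<omega>)) \<in> borel_measurable M"
proof -
  show "p a \<in> borel_measurable M"
    using params_indep assms by (auto simp: indep_vars_def)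
  then have "(\<lambda>\<omega>. fst (p a \<omega>)) \<in> borel_measurable M" "(\<lambda>\<omega>. snd (p a \<omega>)) \<in> borel_measurable M"
    by (simp_all add: borel_prod[symmetric])
  then show "(\<lambda>\<omega>. component g (p a \<omega>)) \<in> borel_measurable M"
    by (cases g) simp_all
qed

lemma subalgebra_params: "subalgebra M (params_algebra M A p)"
proof -
  have "(\<lambda>\<omega>. \<lambda>a\<in>A. p a \<omega>) \<in> measurable M (\<Pi>\<^sub>M a\<in>A. borel)"
    by (intro measurable_restrict measurable_component_params)
  then show ?thesis
    unfolding subalgebra_def params_algebra_def
    by (intro conjI sets_image_in_sets refl) simp_all
qed

sublocale finite_measure_subalgebra M "params_algebra M A p"
  by unfold_locales (rule subalgebra_params)

lemma measurable_outcome [measurable]: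
  assumes "a \<in> A" "t \<in> {1..T}"
  shows "W a t \<in> measurable M (count_space UNIV)"
  using outcomes_cond_indep assms by (force simp: cond_indep_vars_def)

text \<open>
  The event that arm \<open>a\<close> has the outcomes \<open>w a t\<close> at all times \<open>t\<close> in \<open>S a\<close>. The pattern \<open>S\<close> and the
  outcomes \<open>w\<close> do not depend on chance.
\<close>

definition cylinder :: "('a \<Rightarrow> nat set) \<Rightarrow> ('a \<Rightarrow> nat \<Rightarrow> outcome) \<Rightarrow> 'w set" where
  "cylinder S w = {\<omega> \<in> space M. \<forall>a\<in>A. \<forall>t\<in>S a. W a t \<omega> = w a t}"

text \<open>The prior count of \<open>g\<close> for arm \<open>a\<close>, updated by the outcomes recorded in \<open>S\<close> and \<open>w\<close>.\<close>

definition posterior :: "('a \<Rightarrow> nat set) \<Rightarrow> ('a \<Rightarrow> nat \<Rightarrow> outcome) \<Rightarrow> 'a \<Rightarrow> outcome \<Rightarrow> nat" where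
  "posterior S w a g = component g (n a) + card {t \<in> S a. w a t = g}"

lemma sets_cylinder:
  assumes "\<And>a. a \<in> A \<Longrightarrow> S a \<subseteq> {1..T}"
  shows "cylinder S w \<in> sets M"
  unfolding cylinder_def
proof (intro sets.sets_Collect_finite_All finite_arms)
  fix a t assume "a \<in> A" "t \<in> S a"
  then show "{\<omega> \<in> space M. W a t \<omega> = w a t} \<in> sets M"
    using assms[of a] measurable_sets[OF measurable_outcome, of a t "{w a t}"]
    by (auto simp: vimage_def Int_def conj_commute subset_iff)
next
  fix a assume "a \<in> A"
  with assms show "finite (S a)" by (metis finite_atLeastAtMost finite_subset)
qed

text \<open>
  The outcomes up to the horizon form a vector with finitely many values, so functions of this
  vector have finite range and, when real-valued, are integrable.
\<close>

lemma finite_outcome_determined: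
  assumes X: "\<And>\<omega> \<omega>'. \<omega> \<in> space M \<Longrightarrow> \<omega>' \<in> space M \<Longrightarrow>
    (\<And>a t. a \<in> A \<Longrightarrow> t \<in> {1..T} \<Longrightarrow> W a t \<omega>' = W a t \<omega>) \<Longrightarrow> X \<omega>' = X \<omega>"
  shows "finite (X ` space M)"
proof -
  define V where "V \<omega> = (\<lambda>(a, t)\<in>A \<times> {1..T}. W a t \<omega>)" for \<omega>
  define Y where "Y v = X (SOME \<omega>. \<omega> \<in> space M \<and> V \<omega> = v)" for v
  have "Y (V \<omega>) = X \<omega>" if \<omega>: "\<omega> \<in> space M" for \<omega>
  proof -
    have some: "(SOME \<omega>'. \<omega>' \<in> space M \<and> V \<omega>' = V \<omega>) \<in> space M \<and>
        V (SOME \<omega>'. \<omega>' \<in> space M \<and> V \<omega>' = V \<omega>) = V \<omega>"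
      by (rule someI[of "\<lambda>\<omega>'. \<omega>' \<in> space M \<and> V \<omega>' = V \<omega>" \<omega>]) (use \<omega> in simp)
    show ?thesis unfolding Y_def
    proof (rule X[OF \<omega>])
      fix a t assume "a \<in> A" "t \<in> {1..T}"
      with fun_cong[OF conjunct2[OF some], of "(a, t)"]
      show "W a t (SOME \<omega>'. \<omega>' \<in> space M \<and> V \<omega>' = V \<omega>) = W a t \<omega>"
        by (simp add: V_def)
    qed (use some in simp)
  qed
  then have "X ` space M \<subseteq> Y ` V ` space M"
    by (force simp: image_iff)
  moreover have "finite (V ` space M)"
  proof (rule finite_subset)
    show "V ` space M \<subseteq> (A \<times> {1..T}) \<rightarrow>\<^sub>E {Bad, Good}"
      using outcome.exhaust by (auto simp: V_def PiE_def Pi_def extensional_def)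
    show "finite ((A \<times> {1..T}) \<rightarrow>\<^sub>E {Bad, Good})"
      using finite_arms by (intro finite_PiE) auto
  qed
  ultimately show ?thesis by (meson finite_imageI finite_subset)
qed

lemma integrable_outcome_determined:
  fixes X :: "'w \<Rightarrow> real"
  assumes X: "\<And>\<omega> \<omega>'. \<omega> \<in> space M \<Longrightarrow> \<omega>' \<in> space M \<Longrightarrow>
    (\<And>a t. a \<in> A \<Longrightarrow> t \<in> {1..T} \<Longrightarrow> W a t \<omega>' = W a t \<omega>) \<Longrightarrow> X \<omega>' = X \<omega>"
  shows "integrable M X"
proof -
  let ?atom = "\<lambda>\<omega>. cylinder (\<lambda>_. {1..T}) (\<lambda>a t. W a t \<omega>)"
  have "X -` {x} \<inter> space M \<in> sets M" for x
  proof -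
    have "X -` {x} \<inter> space M = \<Union> (?atom ` (X -` {x} \<inter> space M))"
    proof (intro equalityI subsetI)
      fix \<omega> assume "\<omega> \<in> \<Union> (?atom ` (X -` {x} \<inter> space M))"
      then obtain \<omega>' where \<omega>': "\<omega>' \<in> space M" "X \<omega>' = x" "\<omega> \<in> ?atom \<omega>'" by auto
      then have "X \<omega> = X \<omega>'" by (intro X) (auto simp: cylinder_def)
      with \<omega>' show "\<omega> \<in> X -` {x} \<inter> space M" by (auto simp: cylinder_def)
    qed (auto simp: cylinder_def)
    moreover have "finite (?atom ` (X -` {x} \<inter> space M))"
    proof (rule finite_subset)
      show "finite (?atom ` space M)"
        by (rule finite_outcome_determined) (auto simp: cylinder_def)
    qed auto
    moreover have "?atom ` (X -` {x} \<inter> space M) \<subseteq> sets M"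
      using sets_cylinder[of "\<lambda>_. {1..T}"] by auto
    ultimately show ?thesis using sets.finite_Union by (metis (no_types, lifting))
  qed
  moreover have "finite (X ` space M)"
    by (rule finite_outcome_determined) (rule X)
  ultimately have "simple_function M X"
    by (simp add: simple_function_def)
  then show ?thesis
    by (intro integrable_simple_function) (simp_all add: emeasure_eq_measure)
qed

text \<open>
  Conditionally on the parameters the cylinder has as probability the product of the parameters
  of the outcomes that it fixes. Independence of the arms then leaves one Beta moment for each arm.
\<close>

lemma prob_cylinder:
  assumes S: "\<And>a. a \<in> A \<Longrightarrow> S a \<subseteq> {1..T}"
  shows "prob (cylinder S w) =
    (\<Prod>a\<in>A. Beta (real (posterior S w a Bad)) (real (posterior S w a Good)) /
      Beta (real (component Bad (n a))) (real (component Good (n a))))"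
proof -
  define J where "J = Sigma A S"
  let ?F = "params_algebra M A p"
  let ?X = "\<lambda>(a, t). W a t"
  let ?c = "\<lambda>(a, t). {w a t}"
  have J: "J \<subseteq> A \<times> {1..T}" using S by (auto simp: J_def)
  have fin_S: "finite (S a)" if "a \<in> A" for a
    using S[OF that] by (rule finite_subset) simp
  have fin_J: "finite J" using J finite_arms finite_subset by blast
  have cyl: "cylinder S w = (\<Inter>j\<in>J. ?X j -` ?c j \<inter> space M)" if "J \<noteq> {}"
    using that by (auto simp: cylinder_def J_def)
  have "prob (cylinder S w) = expectation (\<lambda>\<omega>. \<Prod>j\<in>J. component (w (fst j) (snd j)) (p (fst j) \<omega>))"
  proof (cases "J = {}")
    case True
    then have "cylinder S w = space M" by (auto simp: cylinder_def J_def)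
    then show ?thesis using True by (simp add: prob_space)
  next
    case False
    \<comment> \<open>Conditional independence is only available for nonempty index sets.\<close>
    have "AE \<omega> in M. real_cond_exp M ?F (indicator (cylinder S w)) \<omega> =
        (\<Prod>j\<in>J. real_cond_exp M ?F (indicator (?X j -` ?c j \<inter> space M)) \<omega>)"
    proof -
      have "?c \<in> (\<Pi> j\<in>J. sets (count_space UNIV))" by auto
      then show ?thesis
        using outcomes_cond_indep J False fin_J unfolding cyl[OF False] cond_indep_vars_def by blast
    qed
    moreover have "AE \<omega> in M. \<forall>j\<in>J. real_cond_exp M ?F (indicator (?X j -` ?c j \<inter> space M)) \<omega> =
        component (w (fst j) (snd j)) (p (fst j) \<omega>)"
      using J fin_J outcomes_cond_law by (intro AE_finite_allI) auto
    ultimately have AE: "AE \<omega> in M. real_cond_exp M ?F (indicator (cylinder S w)) \<omega> =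
        (\<Prod>j\<in>J. component (w (fst j) (snd j)) (p (fst j) \<omega>))"
      by eventually_elim simp
    have "prob (cylinder S w) = expectation (real_cond_exp M ?F (indicator (cylinder S w)))"
      using sets_cylinder[OF S] by (subst real_cond_exp_int(2)) (auto simp: less_top[symmetric])
    also have "\<dots> = expectation (\<lambda>\<omega>. \<Prod>j\<in>J. component (w (fst j) (snd j)) (p (fst j) \<omega>))"
      using AE J by (intro integral_cong_AE) (auto intro!: borel_measurable_prod measurable_component_params)
    finally show ?thesis .
  qed
  also have "\<dots> = expectation (\<lambda>\<omega>. \<Prod>a\<in>A. component Bad (p a \<omega>) ^ card {t\<in>S a. w a t = Bad} *
      (1 - component Bad (p a \<omega>)) ^ card {t\<in>S a. w a t = Good})"
  proof (intro Bochner_Integration.integral_cong refl)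
    fix \<omega> assume "\<omega> \<in> space M"
    then have "(\<Prod>t\<in>S a. component (w a t) (p a \<omega>)) =
        component Bad (p a \<omega>) ^ card {t\<in>S a. w a t = Bad} *
        (1 - component Bad (p a \<omega>)) ^ card {t\<in>S a. w a t = Good}" if "a \<in> A" for a
      using params_sum[OF that] fin_S[OF that] by (intro prod_component_eq) auto
    then show "(\<Prod>j\<in>J. component (w (fst j) (snd j)) (p (fst j) \<omega>)) =
        (\<Prod>a\<in>A. component Bad (p a \<omega>) ^ card {t\<in>S a. w a t = Bad} *
        (1 - component Bad (p a \<omega>)) ^ card {t\<in>S a. w a t = Good})"
      using finite_arms fin_S prod.Sigma[of A S "\<lambda>a t. component (w a t) (p a \<omega>)"]
      by (simp add: J_def case_prod_beta)
  qed
  also have "\<dots> = (\<Prod>a\<in>A. expectation (\<lambda>\<omega>. component Bad (p a \<omega>) ^ card {t\<in>S a. w a t = Bad} *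
      (1 - component Bad (p a \<omega>)) ^ card {t\<in>S a. w a t = Good}))"
  proof (rule indep_vars_lebesgue_integral[OF finite_arms])
    show "indep_vars (\<lambda>_. borel) (\<lambda>a \<omega>. component Bad (p a \<omega>) ^ card {t\<in>S a. w a t = Bad} *
      (1 - component Bad (p a \<omega>)) ^ card {t\<in>S a. w a t = Good}) A"
      by (rule indep_vars_compose2[OF params_indep]) (simp add: borel_prod[symmetric])
  next
    fix a assume "a \<in> A"
    with prior_pos[OF this, of Bad] prior_pos[OF this, of Good]
    show "integrable M (\<lambda>\<omega>. component Bad (p a \<omega>) ^ card {t\<in>S a. w a t = Bad} *
      (1 - component Bad (p a \<omega>)) ^ card {t\<in>S a. w a t = Good})"
      by (intro beta_moments(1)[OF prob_space_axioms params_beta]) auto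
  qed
  also have "\<dots> = (\<Prod>a\<in>A. Beta (real (posterior S w a Bad)) (real (posterior S w a Good)) /
      Beta (real (component Bad (n a))) (real (component Good (n a))))"
  proof (intro prod.cong refl)
    fix a assume "a \<in> A"
    with prior_pos[OF this, of Bad] prior_pos[OF this, of Good]
    show "expectation (\<lambda>\<omega>. component Bad (p a \<omega>) ^ card {t\<in>S a. w a t = Bad} *
      (1 - component Bad (p a \<omega>)) ^ card {t\<in>S a. w a t = Good}) =
      Beta (real (posterior S w a Bad)) (real (posterior S w a Good)) /
      Beta (real (component Bad (n a))) (real (component Good (n a)))"
      by (subst beta_moments(2)[OF prob_space_axioms params_beta]) (auto simp: posterior_def)
  qed
  finally show ?thesis .
qed

text \<open>
  Extending a cylinder by one outcome raises a single argument of a single Beta value by one.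
\<close>

lemma prob_next_outcome:
  assumes S: "\<And>a. a \<in> A \<Longrightarrow> S a \<subseteq> {1..T}"
    and a: "a \<in> A" and t: "t \<in> {1..T}" "t \<notin> S a"
  shows "prob (cylinder S w \<inter> {\<omega> \<in> space M. W a t \<omega> = g}) =
    real (posterior S w a g) / (real (posterior S w a Bad) + real (posterior S w a Good)) *
    prob (cylinder S w)"
proof -
  define S' where "S' = S(a := insert t (S a))"
  define w' where "w' = w(a := (w a)(t := g))"
  let ?Q = "\<lambda>S w a. Beta (real (posterior S w a Bad)) (real (posterior S w a Good)) /
      Beta (real (component Bad (n a))) (real (component Good (n a)))"
  have fin: "finite (S a)" using S[OF a] by (rule finite_subset) simp
  have pos: "0 < posterior S w a h" for h
    using prior_pos[OF a, of h] by (simp add: posterior_def)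
  have "{s \<in> insert t (S a). (if s = t then g else w a s) = h} =
      (if h = g then insert t {s \<in> S a. w a s = h} else {s \<in> S a. w a s = h})" for h
    using t(2) by auto
  then have post: "posterior S' w' a h = posterior S w a h + of_bool (h = g)" for h
    using fin t(2) by (auto simp: posterior_def S'_def w'_def)
  have "cylinder S w \<inter> {\<omega> \<in> space M. W a t \<omega> = g} = cylinder S' w'"
    using a t(2) by (auto simp: cylinder_def S'_def w'_def)
  also have "prob (cylinder S' w') = (\<Prod>a\<in>A. ?Q S' w' a)"
    using S a t by (intro prob_cylinder) (auto simp: S'_def split: if_splits)
  also have "\<dots> = ?Q S' w' a * (\<Prod>b\<in>A - {a}. ?Q S' w' b)"
    using finite_arms a by (rule prod.remove)
  also have "(\<Prod>b\<in>A - {a}. ?Q S' w' b) = (\<Prod>b\<in>A - {a}. ?Q S w b)"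
    by (intro prod.cong refl) (auto simp: posterior_def S'_def w'_def)
  also have "?Q S' w' a = real (posterior S w a g) /
      (real (posterior S w a Bad) + real (posterior S w a Good)) * ?Q S w a"
    using pos[of Bad] pos[of Good] Beta_succ_component[of "real (posterior S w a Bad)" "real (posterior S w a Good)"]
    by (cases g) (simp_all add: post add.commute)
  also have "\<dots> * (\<Prod>b\<in>A - {a}. ?Q S w b) = real (posterior S w a g) /
      (real (posterior S w a Bad) + real (posterior S w a Good)) * (\<Prod>a\<in>A. ?Q S w a)"
    using prod.remove[OF finite_arms a, of "?Q S w"] by simp
  also have "(\<Prod>a\<in>A. ?Q S w a) = prob (cylinder S w)"
    using S by (intro prob_cylinder[symmetric])
  finally show ?thesis .
qed

end


section \<open>Histories of an admissible control\<close>

lemma sigma_sets_separation: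
  assumes "S \<in> sigma_sets \<Omega> G" and "x \<in> \<Omega>" "y \<in> \<Omega>"
    and "\<And>B. B \<in> G \<Longrightarrow> x \<in> B \<longleftrightarrow> y \<in> B"
  shows "x \<in> S \<longleftrightarrow> y \<in> S"
  using assms(1) by induction (use assms in auto)

text \<open>
  A set in the history algebra cannot separate two sample points with the same history, and neither
  can a measurable function into a discrete space.
\<close>

lemma history_measurable_eq:
  assumes F: "F \<in> measurable (history_algebra M A W U t) (count_space UNIV)"
    and \<omega>: "\<omega> \<in> space M" "\<omega>' \<in> space M"
    and U: "\<And>a s. a \<in> A \<Longrightarrow> s < t \<Longrightarrow> U a s \<omega>' = U a s \<omega>"
    and Y: "\<And>a s. a \<in> A \<Longrightarrow> s \<in> {1..t} \<Longrightarrow> observation W U a s \<omega>' = observation W U a s \<omega>"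
  shows "F \<omega>' = F \<omega>"
proof -
  let ?G = "{U a s -` C \<inter> space M | a s C. a \<in> A \<and> s \<in> {0..<t}} \<union>
      {observation W U a s -` C \<inter> space M | a s C. a \<in> A \<and> s \<in> {1..t}}"
  have G: "?G \<subseteq> Pow (space M)" by auto
  have "F -` {F \<omega>} \<inter> space M \<in> sigma_sets (space M) ?G"
    using measurable_sets[OF F, of "{F \<omega>}"] G
    by (simp add: history_algebra_def space_measure_of_conv sets_measure_of_conv)
  then have "\<omega> \<in> F -` {F \<omega>} \<inter> space M \<longleftrightarrow> \<omega>' \<in> F -` {F \<omega>} \<inter> space M"
    by (rule sigma_sets_separation) (use \<omega> U Y in auto)
  with \<omega> show ?thesis by simp
qed

text \<open>A bandit together with an admissible control \<open>U\<close>.\<close>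

locale controlled_bandit = proper_bandit M A T n p W
  for M :: "'w measure" and A :: "'a set" and T n p W +
  fixes U :: "'a \<Rightarrow> nat \<Rightarrow> 'w \<Rightarrow> nat"
  assumes admissible: "admissible M A T W U"
begin

abbreviation state :: "'a \<Rightarrow> nat \<Rightarrow> 'w \<Rightarrow> nat \<times> nat" where
  "state a t \<omega> \<equiv> arm_state n W U a t \<omega>"

text \<open>
  The times at which arm \<open>a\<close> is observed up to time \<open>t\<close>. A pull at time \<open>s\<close> is observed at
  time \<open>s + 1\<close>, hence the shift by one.
\<close>

definition pulled :: "nat \<Rightarrow> 'w \<Rightarrow> 'a \<Rightarrow> nat set" where
  "pulled t \<omega> a = {s \<in> {1..t}. U a (s - 1) \<omega> = 1}"

text \<open>
  All sample points that agree with \<open>\<omega>\<close> on what is observed along \<open>\<omega>\<close> up to time \<open>t\<close>. By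
  \<open>cell_eq\<close> below the cells of a given time partition the sample space.
\<close>

definition cell :: "nat \<Rightarrow> 'w \<Rightarrow> 'w set" where
  "cell t \<omega> = cylinder (pulled t \<omega>) (\<lambda>a s. W a s \<omega>)"

lemma control_range:
  assumes "\<omega> \<in> space M" "t < T" "a \<in> A"
  shows "U a t \<omega> = 0 \<or> U a t \<omega> = 1"
  using admissible assms by (auto simp: admissible_def)

lemma control_sum:
  assumes "\<omega> \<in> space M" "t < T"
  shows "(\<Sum>a\<in>A. real (U a t \<omega>)) = 1"
proof -
  have "(\<Sum>a\<in>A. U a t \<omega>) = 1"
    using admissible assms by (auto simp: admissible_def)
  then show ?thesis by (metis of_nat_1 of_nat_sum)
qed

lemma cell_self: "\<omega> \<in> space M \<Longrightarrow> \<omega> \<in> cell t \<omega>"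
  by (simp add: cell_def cylinder_def)

lemma cell_space: "\<omega>' \<in> cell t \<omega> \<Longrightarrow> \<omega>' \<in> space M"
  by (simp add: cell_def cylinder_def)

lemma cell_outcome:
  assumes "\<omega>' \<in> cell t \<omega>" "a \<in> A" "s < t" "U a s \<omega> = 1"
  shows "W a (Suc s) \<omega>' = W a (Suc s) \<omega>"
  using assms by (auto simp: cell_def cylinder_def pulled_def)

text \<open>
  The choice at time \<open>t\<close> is still constant on the cell of time \<open>t\<close>, as it depends only on the
  observations up to time \<open>t\<close>.
\<close>

lemma cell_control:
  assumes \<omega>: "\<omega> \<in> space M" "\<omega>' \<in> cell t \<omega>" and "s \<le> t" "s < T" "a \<in> A"
  shows "U a s \<omega>' = U a s \<omega>"
  using assms(3-)
proof (induction s arbitrary: a rule: less_induct)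
  case (less s)
  have \<omega>': "\<omega>' \<in> space M" using \<omega>(2) by (rule cell_space)
  show ?case
  proof (cases "s = 0")
    case True
    obtain u where "\<forall>a\<in>A. \<forall>\<omega>\<in>space M. U a 0 \<omega> = u a"
      using admissible by (auto simp: admissible_def)
    with True less.prems \<omega>(1) \<omega>' show ?thesis by simp
  next
    case False
    with less.prems admissible
    have "U a s \<in> measurable (history_algebra M A W U s) (count_space UNIV)"
      by (auto simp: admissible_def)
    then show ?thesis
    proof (rule history_measurable_eq[OF _ \<omega>(1) \<omega>'])
      fix b r assume b: "b \<in> A" "r < s"
      then show "U b r \<omega>' = U b r \<omega>" using less.IH[of r b] less.prems by simp
    next
      fix b r assume b: "b \<in> A" "r \<in> {1..s}"
      then have U: "U b (r - 1) \<omega>' = U b (r - 1) \<omega>"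
        using less.IH[of "r - 1" b] less.prems by auto
      have "W b r \<omega>' = W b r \<omega>" if "U b (r - 1) \<omega> = 1"
        using cell_outcome[OF \<omega>(2) b(1) _ that] b(2) less.prems by auto
      with U show "observation W U b r \<omega>' = observation W U b r \<omega>"
        by (simp add: observation_def)
    qed
  qed
qed

lemma cell_eq:
  assumes "\<omega> \<in> space M" "\<omega>' \<in> cell t \<omega>" "t \<le> T"
  shows "cell t \<omega>' = cell t \<omega>"
proof -
  have "pulled t \<omega>' a = pulled t \<omega> a" if "a \<in> A" for a
    using cell_control[OF assms(1,2) _ _ that] assms(3) by (auto simp: pulled_def)
  moreover have "\<forall>a\<in>A. \<forall>s\<in>pulled t \<omega> a. W a s \<omega>' = W a s \<omega>"
    using assms(2) by (simp add: cell_def cylinder_def)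
  ultimately show ?thesis by (auto simp: cell_def cylinder_def)
qed

lemma cell_state:
  assumes "\<omega> \<in> space M" "\<omega>' \<in> cell t \<omega>" "t \<le> T" "a \<in> A"
  shows "state a t \<omega>' = state a t \<omega>"
proof -
  have "U a s \<omega>' * of_bool (W a (s + 1) \<omega>' = g) = U a s \<omega> * of_bool (W a (s + 1) \<omega> = g)"
    if "s < t" for s g
    using cell_control[OF assms(1,2), of s a] control_range[OF assms(1), of s a]
      cell_outcome[OF assms(2,4) that] that assms(3,4) by auto
  then have "arm_count n W U a g t \<omega>' = arm_count n W U a g t \<omega>" for g
    by (simp add: arm_count_def)
  then show ?thesis by (simp add: arm_state_def)
qed

lemma posterior_pulled:
  assumes "\<omega> \<in> space M" "t \<le> T" "a \<in> A"
  shows "posterior (pulled t \<omega>) (\<lambda>a s. W a s \<omega>) a g = component g (state a t \<omega>)"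
proof -
  have "(\<Sum>s\<in>{0..<t}. U a s \<omega> * of_bool (W a (s + 1) \<omega> = g)) =
      (\<Sum>s\<in>{0..<t}. of_bool (U a s \<omega> = 1 \<and> W a (s + 1) \<omega> = g))"
  proof (intro sum.cong refl)
    fix s assume "s \<in> {0..<t}"
    then have "U a s \<omega> = 0 \<or> U a s \<omega> = 1" using assms by (intro control_range) auto
    then show "U a s \<omega> * of_bool (W a (s + 1) \<omega> = g) = of_bool (U a s \<omega> = 1 \<and> W a (s + 1) \<omega> = g)"
      by auto
  qed
  also have "\<dots> = card {s\<in>{0..<t}. U a s \<omega> = 1 \<and> W a (s + 1) \<omega> = g}"
    by (simp add: Int_def)
  also have "\<dots> = card {s \<in> pulled t \<omega> a. W a s \<omega> = g}"
    by (rule bij_betw_same_card[OF bij_betw_byWitness[where f = Suc and f' = "\<lambda>s. s - 1"]])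
      (auto simp: pulled_def)
  finally show ?thesis
    by (cases g) (simp_all add: posterior_def arm_state_def arm_count_def)
qed

lemma state_pos:
  assumes "a \<in> A"
  shows "0 < component g (state a t \<omega>)"
  using prior_pos[OF assms, of g] by (cases g) (simp_all add: arm_state_def arm_count_def)

lemma cell_if_outcomes_eq:
  assumes "\<omega> \<in> space M" "\<omega>' \<in> space M" "t \<le> T"
    and "\<And>a t. a \<in> A \<Longrightarrow> t \<in> {1..T} \<Longrightarrow> W a t \<omega>' = W a t \<omega>"
  shows "\<omega>' \<in> cell t \<omega>"
  using assms by (auto simp: cell_def cylinder_def pulled_def)

lemma integrable_state:
  assumes "t \<le> T" "a \<in> A"
  shows "integrable M (\<lambda>\<omega>. f (state a t \<omega>) :: real)"
  using cell_state cell_if_outcomes_eq assms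
  by (intro integrable_outcome_determined arg_cong[of _ _ f]) metis

lemma integrable_state_control_outcome:
  assumes "t < T" "a \<in> A"
  shows "integrable M (\<lambda>\<omega>. f (state a t \<omega>) (U a t \<omega>) (W a (t + 1) \<omega>) :: real)"
proof (rule integrable_outcome_determined)
  fix \<omega> \<omega>' assume \<omega>: "\<omega> \<in> space M" "\<omega>' \<in> space M"
    and W: "\<And>a t. a \<in> A \<Longrightarrow> t \<in> {1..T} \<Longrightarrow> W a t \<omega>' = W a t \<omega>"
  then have "\<omega>' \<in> cell t \<omega>" using assms(1) by (intro cell_if_outcomes_eq) auto
  then have "state a t \<omega>' = state a t \<omega>" "U a t \<omega>' = U a t \<omega>"
    using cell_state[OF \<omega>(1)] cell_control[OF \<omega>(1)] assms by auto
  moreover have "W a (t + 1) \<omega>' = W a (t + 1) \<omega>" using W assms by simp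
  ultimately show "f (state a t \<omega>') (U a t \<omega>') (W a (t + 1) \<omega>') =
      f (state a t \<omega>) (U a t \<omega>) (W a (t + 1) \<omega>)" by simp
qed

lemma integrable_state_control:
  assumes "t < T" "a \<in> A"
  shows "integrable M (\<lambda>\<omega>. f (state a t \<omega>) (U a t \<omega>) :: real)"
  using integrable_state_control_outcome[OF assms, of "\<lambda>x u _. f x u"] .

section \<open>Predictive law of the next outcome\<close>

lemma prob_cell_next_outcome:
  assumes "\<omega> \<in> space M" "t < T" "a \<in> A"
  shows "prob (cell t \<omega> \<inter> {\<omega>' \<in> space M. W a (t + 1) \<omega>' = g}) =
    real (component g (state a t \<omega>)) /
      (real (component Bad (state a t \<omega>)) + real (component Good (state a t \<omega>))) *
    prob (cell t \<omega>)"
  using assms unfolding cell_def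
  by (subst prob_next_outcome) (auto simp: pulled_def posterior_pulled simp del: component.simps)

text \<open>
  Given the past, arm \<open>a\<close> in state \<open>(b, g)\<close> produces the next outcome with odds \<open>b : g\<close>. The past
  enters through test functions of the current state and choice of that arm.
\<close>

lemma predictive_law:
  fixes f :: "nat \<times> nat \<Rightarrow> nat \<Rightarrow> real"
  assumes t: "t < T" and a: "a \<in> A"
  shows "expectation (\<lambda>\<omega>. f (state a t \<omega>) (U a t \<omega>) * of_bool (W a (t + 1) \<omega> = g)) =
    expectation (\<lambda>\<omega>. f (state a t \<omega>) (U a t \<omega>) *
      (real (component g (state a t \<omega>)) /
        (real (component Bad (state a t \<omega>)) + real (component Good (state a t \<omega>)))))"
proof -
  let ?E = "{\<omega> \<in> space M. W a (t + 1) \<omega> = g}"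
  define r where "r x = real (component g x) / (real (component Bad x) + real (component Good x))"
    for x :: "nat \<times> nat"
  let ?X = "\<lambda>\<omega>. f (state a t \<omega>) (U a t \<omega>)"
  define D where "D \<omega> = ?X \<omega> * of_bool (W a (t + 1) \<omega> = g) - ?X \<omega> * r (state a t \<omega>)" for \<omega>
  have int: "integrable M (\<lambda>\<omega>. ?X \<omega> * of_bool (W a (t + 1) \<omega> = g))"
    "integrable M (\<lambda>\<omega>. ?X \<omega> * r (state a t \<omega>))"
    by (rule integrable_state_control_outcome[OF t a, of "\<lambda>x u h. f x u * of_bool (h = g)"])
      (rule integrable_state_control[OF t a, of "\<lambda>x u. f x u * r x"])
  \<comment> \<open>\<open>D\<close> has zero expectation on each of the finitely many cells, which partition the space.\<close>
  let ?C = "cell t ` space M"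
  have E: "?E \<in> sets M"
    using measurable_sets[OF measurable_outcome[OF a], of "t + 1" "{g}"] t
    by (simp add: vimage_def Int_def conj_commute)
  have cell_sets: "cell t \<omega> \<in> sets M" for \<omega>
    unfolding cell_def using t by (intro sets_cylinder) (auto simp: pulled_def)
  have finite_cells: "finite ?C"
  proof (rule finite_outcome_determined)
    fix \<omega> \<omega>' assume \<omega>: "\<omega> \<in> space M" "\<omega>' \<in> space M"
      and W: "\<And>a t. a \<in> A \<Longrightarrow> t \<in> {1..T} \<Longrightarrow> W a t \<omega>' = W a t \<omega>"
    then have "\<omega>' \<in> cell t \<omega>" using t by (intro cell_if_outcomes_eq) auto
    then show "cell t \<omega>' = cell t \<omega>" using \<omega>(1) t by (intro cell_eq) simp_all
  qed
  have D_int: "integrable M D"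
    unfolding D_def using int by (rule Bochner_Integration.integrable_diff)
  have cell_zero: "expectation (\<lambda>\<omega>. indicat_real c \<omega> * D \<omega>) = 0" if "c \<in> ?C" for c
  proof -
    from that obtain \<omega>0 where \<omega>0: "\<omega>0 \<in> space M" and c: "c = cell t \<omega>0" by auto
    have "expectation (\<lambda>\<omega>. indicat_real c \<omega> * D \<omega>) =
        expectation (\<lambda>\<omega>. ?X \<omega>0 * (indicat_real (c \<inter> ?E) \<omega> - r (state a t \<omega>0) * indicat_real c \<omega>))"
    proof (intro Bochner_Integration.integral_cong refl)
      fix \<omega> assume "\<omega> \<in> space M"
      then show "indicat_real c \<omega> * D \<omega> =
          ?X \<omega>0 * (indicat_real (c \<inter> ?E) \<omega> - r (state a t \<omega>0) * indicat_real c \<omega>)"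
        using cell_state[OF \<omega>0, of \<omega> t a] cell_control[OF \<omega>0, of \<omega> t t a] t a
        by (auto simp: c D_def indicator_def algebra_simps)
    qed
    also have "\<dots> = ?X \<omega>0 * (prob (c \<inter> ?E) - r (state a t \<omega>0) * prob c)"
      using cell_sets[of \<omega>0] E by (simp add: c less_top[symmetric])
    also have "\<dots> = 0"
      using prob_cell_next_outcome[OF \<omega>0 t a] by (simp add: c r_def del: component.simps)
    finally show ?thesis .
  qed
  have "expectation D = expectation (\<lambda>\<omega>. \<Sum>c\<in>?C. indicat_real c \<omega> * D \<omega>)"
  proof (intro Bochner_Integration.integral_cong refl)
    fix \<omega> assume \<omega>: "\<omega> \<in> space M"
    have "\<omega> \<in> c \<longleftrightarrow> c = cell t \<omega>" if "c \<in> ?C" for c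
    proof -
      from that obtain \<omega>0 where \<omega>0: "\<omega>0 \<in> space M" "c = cell t \<omega>0" by blast
      then have "cell t \<omega> = c" if "\<omega> \<in> c"
        using cell_eq[OF \<omega>0(1), of \<omega> t] that t by simp
      with cell_self[OF \<omega>] show ?thesis by blast
    qed
    then have "(\<Sum>c\<in>?C. indicat_real c \<omega> * D \<omega>) = (\<Sum>c\<in>?C. if c = cell t \<omega> then D \<omega> else 0)"
      by (intro sum.cong refl) (simp add: indicator_def)
    also have "\<dots> = D \<omega>" using finite_cells \<omega> by simp
    finally show "D \<omega> = (\<Sum>c\<in>?C. indicat_real c \<omega> * D \<omega>)" by simp
  qed
  also have "\<dots> = (\<Sum>c\<in>?C. expectation (\<lambda>\<omega>. indicat_real c \<omega> * D \<omega>))"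
  proof (intro Bochner_Integration.integral_sum)
    fix c assume "c \<in> ?C"
    then have "c \<in> sets M" using cell_sets by blast
    then show "integrable M (\<lambda>\<omega>. indicat_real c \<omega> * D \<omega>)"
      using integrable_mult_indicator[OF _ D_int] by simp
  qed
  also have "\<dots> = 0" using cell_zero by (intro sum.neutral) auto
  finally have "expectation D = 0" .
  then show ?thesis
    unfolding D_def using Bochner_Integration.integral_diff[OF int] by (simp add: r_def)
qed

lemma expected_increment:
  fixes \<phi> :: "nat \<times> nat \<Rightarrow> real"
  assumes t: "t < T" and a: "a \<in> A"
  shows "expectation (\<lambda>\<omega>. \<phi> (state a (t + 1) \<omega>) - \<phi> (state a t \<omega>)) =
    expectation (\<lambda>\<omega>. real (U a t \<omega>) * (state_mean \<phi> (state a t \<omega>) - \<phi> (state a t \<omega>)))"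
proof -
  define next_state where "next_state g x =
    (case g of Bad \<Rightarrow> (fst x + 1, snd x) | Good \<Rightarrow> (fst x, snd x + 1))" for g and x :: "nat \<times> nat"
  define f where "f g x u = real u * (\<phi> (next_state g x) - \<phi> x)" for g x u
  define r where "r g x = real (component g x) / (real (component Bad x) + real (component Good x))"
    for g and x :: "nat \<times> nat"
  have int_r: "integrable M (\<lambda>\<omega>. f g (state a t \<omega>) (U a t \<omega>) * r g (state a t \<omega>))" for g
    by (rule integrable_state_control[OF t a, of "\<lambda>x u. f g x u * r g x"])
  have int_W: "integrable M (\<lambda>\<omega>. f g (state a t \<omega>) (U a t \<omega>) * of_bool (W a (t + 1) \<omega> = g))" for g
    by (rule integrable_state_control_outcome[OF t a, of "\<lambda>x u h. f g x u * of_bool (h = g)"])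
  have "expectation (\<lambda>\<omega>. \<phi> (state a (t + 1) \<omega>) - \<phi> (state a t \<omega>)) =
      expectation (\<lambda>\<omega>. f Bad (state a t \<omega>) (U a t \<omega>) * of_bool (W a (t + 1) \<omega> = Bad) +
        f Good (state a t \<omega>) (U a t \<omega>) * of_bool (W a (t + 1) \<omega> = Good))"
  proof (intro Bochner_Integration.integral_cong refl)
    fix \<omega> assume "\<omega> \<in> space M"
    then show "\<phi> (state a (t + 1) \<omega>) - \<phi> (state a t \<omega>) =
        f Bad (state a t \<omega>) (U a t \<omega>) * of_bool (W a (t + 1) \<omega> = Bad) +
        f Good (state a t \<omega>) (U a t \<omega>) * of_bool (W a (t + 1) \<omega> = Good)"
      using control_range[OF _ t a, of \<omega>]
      by (cases "W a (t + 1) \<omega>") (auto simp: f_def next_state_def arm_state_def arm_count_def)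
  qed
  also have "\<dots> = expectation (\<lambda>\<omega>. f Bad (state a t \<omega>) (U a t \<omega>) * r Bad (state a t \<omega>)) +
      expectation (\<lambda>\<omega>. f Good (state a t \<omega>) (U a t \<omega>) * r Good (state a t \<omega>))"
    using Bochner_Integration.integral_add[OF int_W[of Bad] int_W[of Good]]
      predictive_law[OF t a, of "f Bad" Bad] predictive_law[OF t a, of "f Good" Good]
    unfolding r_def by linarith
  also have "\<dots> = expectation (\<lambda>\<omega>. f Bad (state a t \<omega>) (U a t \<omega>) * r Bad (state a t \<omega>) +
      f Good (state a t \<omega>) (U a t \<omega>) * r Good (state a t \<omega>))"
    by (rule Bochner_Integration.integral_add[OF int_r int_r, symmetric])
  also have "\<dots> = expectation (\<lambda>\<omega>. real (U a t \<omega>) * (state_mean \<phi> (state a t \<omega>) - \<phi> (state a t \<omega>)))"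
  proof (intro Bochner_Integration.integral_cong refl)
    fix \<omega>
    obtain b g where x: "state a t \<omega> = (b, g)" by fastforce
    define \<alpha> \<beta> where "\<alpha> = real b / (real b + real g)" and "\<beta> = real g / (real b + real g)"
    have \<beta>: "\<beta> = 1 - \<alpha>"
      using state_pos[OF a, of Bad t \<omega>] x by (simp add: \<alpha>_def \<beta>_def field_simps)
    have r: "r Bad (b, g) = \<alpha>" "r Good (b, g) = \<beta>"
      by (simp_all add: r_def \<alpha>_def \<beta>_def)
    have mean: "state_mean \<phi> (b, g) = \<alpha> * \<phi> (b + 1, g) + \<beta> * \<phi> (b, g + 1)"
      by (simp add: state_mean_def \<alpha>_def \<beta>_def)
    show "f Bad (state a t \<omega>) (U a t \<omega>) * r Bad (state a t \<omega>) +
        f Good (state a t \<omega>) (U a t \<omega>) * r Good (state a t \<omega>) =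
        real (U a t \<omega>) * (state_mean \<phi> (state a t \<omega>) - \<phi> (state a t \<omega>))"
      by (simp add: x f_def next_state_def r mean \<beta> algebra_simps)
  qed
  finally show ?thesis .
qed

end

section \<open>The optimality gap\<close>

text \<open>The maximum in the recursion, rewritten as a positive part.\<close>

lemma arm_value_step:
  assumes "t < T"
  shows "arm_value L T \<mu> a t x = arm_value L T \<mu> a (t + 1) x +
    (arm_index L T \<mu> a t x - \<mu> t) * real (relaxed_control L T \<mu> a t x)"
  using assms by (subst arm_value.simps) (auto simp: arm_index_def relaxed_control_def)

lemma arm_value_horizon: "arm_value L T \<mu> a T x = 0"
  by (subst arm_value.simps) simp

context controlled_bandit
begin

text \<open>
  The telescoped value of a single arm: the gain of the relaxed control minus the drift of the
  value function along the states of the given control.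
\<close>

lemma arm_value_eq_expectation:
  assumes a: "a \<in> A"
  shows "arm_value L T \<mu> a 0 (n a) = expectation (\<lambda>\<omega>. \<Sum>t\<in>{0..<T}.
    (arm_index L T \<mu> a t (state a t \<omega>) - \<mu> t) * real (relaxed_control L T \<mu> a t (state a t \<omega>)) -
    (arm_index L T \<mu> a t (state a t \<omega>) - reward_mean L a t (state a t \<omega>)) * real (U a t \<omega>))"
proof -
  let ?V = "arm_value L T \<mu> a"
  let ?gain = "\<lambda>t \<omega>. (arm_index L T \<mu> a t (state a t \<omega>) - \<mu> t) * real (relaxed_control L T \<mu> a t (state a t \<omega>))"
  let ?drift = "\<lambda>t \<omega>. (arm_index L T \<mu> a t (state a t \<omega>) - reward_mean L a t (state a t \<omega>)) * real (U a t \<omega>)"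
  have int_V: "integrable M (\<lambda>\<omega>. ?V s (state a t \<omega>))" if "t \<le> T" for s t
    using that a by (rule integrable_state)
  have int_gain: "integrable M (?gain t)" if "t < T" for t
    using integrable_state[of t a "\<lambda>x. (arm_index L T \<mu> a t x - \<mu> t) * real (relaxed_control L T \<mu> a t x)"] that a
    by simp
  have int_drift: "integrable M (?drift t)" if "t < T" for t
    using integrable_state_control[OF that a, of "\<lambda>x u. (arm_index L T \<mu> a t x - reward_mean L a t x) * real u"]
    by simp
  have step: "expectation (\<lambda>\<omega>. ?V t (state a t \<omega>)) - expectation (\<lambda>\<omega>. ?V (t + 1) (state a (t + 1) \<omega>)) =
      expectation (\<lambda>\<omega>. ?gain t \<omega> - ?drift t \<omega>)" if t: "t < T" for t
  proof -
    have "expectation (\<lambda>\<omega>. ?V t (state a t \<omega>)) = expectation (\<lambda>\<omega>. ?V (t + 1) (state a t \<omega>)) + expectation (?gain t)"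
      using int_V[of t "t + 1"] int_gain[OF t] t unfolding arm_value_step[OF t]
      by (intro Bochner_Integration.integral_add) auto
    moreover have "expectation (\<lambda>\<omega>. ?V (t + 1) (state a (t + 1) \<omega>)) - expectation (\<lambda>\<omega>. ?V (t + 1) (state a t \<omega>)) =
        expectation (?drift t)"
      using expected_increment[OF t a, of "?V (t + 1)"] int_V[of "t + 1" "t + 1"] int_V[of t "t + 1"] t
      by (simp add: arm_index_def mult.commute)
    ultimately show ?thesis
      using Bochner_Integration.integral_diff[OF int_gain[OF t] int_drift[OF t]] by linarith
  qed
  have "?V 0 (n a) = expectation (\<lambda>\<omega>. ?V 0 (state a 0 \<omega>)) - expectation (\<lambda>\<omega>. ?V T (state a T \<omega>))"
    by (simp add: arm_state_def arm_count_def arm_value_horizon prob_space)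
  also have "\<dots> = (\<Sum>t\<in>{0..<T}. expectation (\<lambda>\<omega>. ?V t (state a t \<omega>)) -
      expectation (\<lambda>\<omega>. ?V (t + 1) (state a (t + 1) \<omega>)))"
    using sum_lessThan_telescope'[of "\<lambda>t. expectation (\<lambda>\<omega>. ?V t (state a t \<omega>))" T]
    by (simp add: atLeast0LessThan)
  also have "\<dots> = (\<Sum>t\<in>{0..<T}. expectation (\<lambda>\<omega>. ?gain t \<omega> - ?drift t \<omega>))"
    using step by (intro sum.cong) auto
  also have "\<dots> = expectation (\<lambda>\<omega>. \<Sum>t\<in>{0..<T}. ?gain t \<omega> - ?drift t \<omega>)"
    using int_gain int_drift
    by (intro Bochner_Integration.integral_sum[symmetric] Bochner_Integration.integrable_diff) auto
  finally show ?thesis .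
qed

lemma optimality_gap:
  "relaxed_value A L T \<mu> n - control_value M A L T n W U =
    expectation (\<lambda>\<omega>. \<Sum>t\<in>{0..<T}. \<Sum>a\<in>A. (arm_index L T \<mu> a t (state a t \<omega>) - \<mu> t) *
      (real (relaxed_control L T \<mu> a t (state a t \<omega>)) - real (U a t \<omega>)))"
proof -
  let ?I = "\<lambda>a t \<omega>. arm_index L T \<mu> a t (state a t \<omega>)"
  let ?l = "\<lambda>a t \<omega>. reward_mean L a t (state a t \<omega>)"
  let ?u = "\<lambda>a t \<omega>. real (relaxed_control L T \<mu> a t (state a t \<omega>))"
  define F where "F a t \<omega> = (?I a t \<omega> - \<mu> t) * ?u a t \<omega> - (?I a t \<omega> - ?l a t \<omega>) * real (U a t \<omega>)" for a t \<omega>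
  have int_F: "integrable M (F a t)" if "t < T" "a \<in> A" for a t
    using integrable_state_control[OF that, of "\<lambda>x u. (arm_index L T \<mu> a t x - \<mu> t) * real (relaxed_control L T \<mu> a t x) -
      (arm_index L T \<mu> a t x - reward_mean L a t x) * real u"] by (simp add: F_def[abs_def])
  have int_l: "integrable M (\<lambda>\<omega>. ?l a t \<omega> * real (U a t \<omega>))" if "t < T" "a \<in> A" for a t
    using integrable_state_control[OF that, of "\<lambda>x u. reward_mean L a t x * real u"] by simp
  have "(\<Sum>a\<in>A. arm_value L T \<mu> a 0 (n a)) = (\<Sum>a\<in>A. expectation (\<lambda>\<omega>. \<Sum>t\<in>{0..<T}. F a t \<omega>))"
    by (intro sum.cong refl) (simp add: arm_value_eq_expectation F_def)
  also have "\<dots> = expectation (\<lambda>\<omega>. \<Sum>a\<in>A. \<Sum>t\<in>{0..<T}. F a t \<omega>)"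
    using int_F by (intro Bochner_Integration.integral_sum[symmetric] Bochner_Integration.integrable_sum) auto
  finally have relaxed: "relaxed_value A L T \<mu> n =
      expectation (\<lambda>\<omega>. \<Sum>a\<in>A. \<Sum>t\<in>{0..<T}. F a t \<omega>) + expectation (\<lambda>\<omega>. \<Sum>t\<in>{0..<T}. \<mu> t)"
    by (simp add: relaxed_value_def prob_space)
  have "relaxed_value A L T \<mu> n - control_value M A L T n W U =
      expectation (\<lambda>\<omega>. (\<Sum>a\<in>A. \<Sum>t\<in>{0..<T}. F a t \<omega>) + (\<Sum>t\<in>{0..<T}. \<mu> t) -
        (\<Sum>t\<in>{0..<T}. \<Sum>a\<in>A. ?l a t \<omega> * real (U a t \<omega>)))"
    unfolding relaxed control_value_def using int_F int_l
    by (subst Bochner_Integration.integral_diff Bochner_Integration.integral_add;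
        (intro Bochner_Integration.integrable_sum Bochner_Integration.integrable_add)?; simp)+
  also have "\<dots> = expectation (\<lambda>\<omega>. \<Sum>t\<in>{0..<T}. \<Sum>a\<in>A. (?I a t \<omega> - \<mu> t) * (?u a t \<omega> - real (U a t \<omega>)))"
  proof (intro Bochner_Integration.integral_cong refl)
    fix \<omega> assume \<omega>: "\<omega> \<in> space M"
    \<comment> \<open>Exactly one arm is pulled at each stage.\<close>
    have "(\<Sum>t\<in>{0..<T}. \<mu> t) = (\<Sum>t\<in>{0..<T}. \<Sum>a\<in>A. \<mu> t * real (U a t \<omega>))"
      using control_sum[OF \<omega>] by (simp add: sum_distrib_left[symmetric])
    moreover have "(\<Sum>a\<in>A. \<Sum>t\<in>{0..<T}. F a t \<omega>) = (\<Sum>t\<in>{0..<T}. \<Sum>a\<in>A. F a t \<omega>)"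
      by (rule sum.swap)
    ultimately show "(\<Sum>a\<in>A. \<Sum>t\<in>{0..<T}. F a t \<omega>) + (\<Sum>t\<in>{0..<T}. \<mu> t) -
        (\<Sum>t\<in>{0..<T}. \<Sum>a\<in>A. ?l a t \<omega> * real (U a t \<omega>)) =
        (\<Sum>t\<in>{0..<T}. \<Sum>a\<in>A. (?I a t \<omega> - \<mu> t) * (?u a t \<omega> - real (U a t \<omega>)))"
      by (simp add: sum.distrib[symmetric] sum_subtractf[symmetric] F_def algebra_simps)
  qed
  finally show ?thesis .
qed

end

theorem theorem2:
  fixes M :: "'w measure" and A :: "'a set" and T :: nat
    and L :: "'a \<Rightarrow> nat \<Rightarrow> outcome \<Rightarrow> real" and \<mu> :: "nat \<Rightarrow> real"
    and n :: "'a \<Rightarrow> nat \<times> nat"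
    and p :: "'a \<Rightarrow> 'w \<Rightarrow> real \<times> real" and W :: "'a \<Rightarrow> nat \<Rightarrow> 'w \<Rightarrow> outcome"
    and U :: "'a \<Rightarrow> nat \<Rightarrow> 'w \<Rightarrow> nat"
  assumes "T \<ge> 1" and "finite A" and "A \<noteq> {}"
    and "\<And>t. t < T \<Longrightarrow> \<mu> t \<ge> 0"
    and "\<And>a g. a \<in> A \<Longrightarrow> component g (n a) \<ge> 1"
    and "bandit M A T n p W"
    and "admissible M A T W U"
  shows "relaxed_value A L T \<mu> n - control_value M A L T n W U =
    prob_space.expectation M (\<lambda>\<omega>. \<Sum>t\<in>{0..<T}. \<Sum>a\<in>A.
      (arm_index L T \<mu> a t (arm_state n W U a t \<omega>) - \<mu> t) *
      (real (relaxed_control L T \<mu> a t (arm_state n W U a t \<omega>)) - real (U a t \<omega>)))"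
proof -
  interpret bandit M A T n p W by fact
  interpret controlled_bandit M A T n p W U
    using assms by unfold_locales auto
  show ?thesis by (rule optimality_gap)
qed

end
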